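(* For all integers $d\ge1$ and $n\ge1$, $$\widetilde{\mathsf{p}}_d(n)\le \widetilde{\mathsf{m}}_d(dn-d+1).$$ In particular, $$\mathsf{p}_d(n)\le (dn-d+1)\,\mathsf{m}_d(dn-d+1).$$
   Context: A $d$-dimensional partition is an array $\pi = (\pi_{i_1,\ldots,i_d})_{i_1,\ldots,i_d\ge 1}$ of nonnegative integers with only finitely many nonzero entries such that $\pi_{i_1,\ldots,i_d}\ge \pi_{j_1,\ldots,j_d}$ whenever $i_1\le j_1,\ldots,i_d\le j_d$. Its volume is $|\pi| = \sum_{i_1,\ldots,i_d}\pi_{i_1,\ldots,i_d}$. $\mathsf{p}_d(n)$ denotes the number of $d$-dimensional partitions of volume $n$, and $\widetilde{\mathsf{p}}_d(n)=\sum_{0\le i\le n}\mathsf{p}_d(i)$ the number of those of volume at most $n$. MacMahon's numbers $\mathsf{m}_d(n)$ are defined by the formal power series identity $$\sum_{n\ge0}\mathsf{m}_d(n)\,x^n=\prod_{n\ge1}(1-x^n)^{-\binom{n+d-2}{d-1}},$$ and $\widetilde{\mathsf{m}}_d(n)=\sum_{0\le i\le n}\mathsf{m}_d(i)$. *)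

theory Defs
  imports "HOL-Analysis.Analysis" "HOL-Computational_Algebra.Formal_Power_Series"
begin

definition multi_index :: "nat \<Rightarrow> nat list set" where
  "multi_index d = {is. length is = d \<and> (\<forall>i\<in>set is. 1 \<le> i)}"

text \<open>
  An array indexed by d-tuples of positive integers is a function on lists of naturals; it is
  required to vanish at every list that is not such a tuple, so that arrays and functions
  correspond bijectively and partitions can be counted.
\<close>

definition partitions :: "nat \<Rightarrow> (nat list \<Rightarrow> nat) set" where
  "partitions d = {\<pi>.
     (\<forall>is. is \<notin> multi_index d \<longrightarrow> \<pi> is = 0) \<and>
     finite {is \<in> multi_index d. \<pi> is \<noteq> 0} \<and>
     (\<forall>is\<in>multi_index d. \<forall>js\<in>multi_index d. list_all2 (\<le>) is js \<longrightarrow> \<pi> is \<ge> \<pi> js)}"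

definition volume :: "nat \<Rightarrow> (nat list \<Rightarrow> nat) \<Rightarrow> nat" where
  "volume d \<pi> = (\<Sum>is \<in> {is \<in> multi_index d. \<pi> is \<noteq> 0}. \<pi> is)"

definition num_partitions :: "nat \<Rightarrow> nat \<Rightarrow> nat" where
  "num_partitions d n = card {\<pi> \<in> partitions d. volume d \<pi> = n}"

definition num_partitions_upto :: "nat \<Rightarrow> nat \<Rightarrow> nat" where
  "num_partitions_upto d n = (\<Sum>i\<le>n. num_partitions d i)"

text \<open>
  The infinite product is taken in the topology of formal power series. Its index k starts at 0,
  so the factor for n is the one with k = n - 1. The natural-number subtractions in the
  binomial coefficient are exact for d at least 1.
\<close>

definition macmahon_factor :: "nat \<Rightarrow> nat \<Rightarrow> rat fps" where
  "macmahon_factor d n = inverse ((1 - fps_X ^ n) ^ ((n + d - 2) choose (d - 1)))"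

definition macmahon_gf :: "nat \<Rightarrow> rat fps" where
  "macmahon_gf d = (\<Prod>k. macmahon_factor d (Suc k))"

definition macmahon :: "nat \<Rightarrow> nat \<Rightarrow> rat" where
  "macmahon d n = fps_nth (macmahon_gf d) n"

definition macmahon_upto :: "nat \<Rightarrow> nat \<Rightarrow> rat" where
  "macmahon_upto d n = (\<Sum>i\<le>n. macmahon d i)"

text \<open>
  Neither \<^const>\<open>card\<close> nor \<^const>\<open>prodinf\<close> takes its default value here: the sets counted are
  finite and the product converges.
\<close>

lemma finite_partitions_volume:
  assumes "d \<ge> 1"
  shows "finite {\<pi> \<in> partitions d. volume d \<pi> = n}"
proof -
  define B where "B = {is :: nat list. set is \<subseteq> {..n} \<and> length is = d}"
  have finB: "finite B" unfolding B_def by (rule finite_lists_length_eq) simp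
  have fin: "finite {\<pi> :: nat list \<Rightarrow> nat. \<forall>is. (is \<in> B \<longrightarrow> \<pi> is \<in> {..n}) \<and> (is \<notin> B \<longrightarrow> \<pi> is = 0)}"
    by (rule finite_set_of_finite_funs[OF finB]) simp
  have "\<pi> is \<le> n \<and> (is \<notin> B \<longrightarrow> \<pi> is = 0)"
    if pi: "\<pi> \<in> partitions d" "volume d \<pi> = n" for \<pi> "is"
  proof (cases "\<pi> is = 0")
    case False
    let ?S = "{is \<in> multi_index d. \<pi> is \<noteq> 0}"
    have finS: "finite ?S" and isS: "is \<in> ?S" using pi False by (auto simp: partitions_def)
    have le: "\<pi> is \<le> n"
      using member_le_sum[OF isS, of \<pi>] finS pi by (simp add: volume_def)
    have cardS: "card ?S \<le> n"
    proof -
      have "card ?S = (\<Sum>is\<in>?S. 1)" by simp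
      also have "\<dots> \<le> (\<Sum>is\<in>?S. \<pi> is)" by (rule sum_mono) auto
      finally show ?thesis using pi by (simp add: volume_def)
    qed
    have "is ! j \<le> n" if j: "j < d" for j
    proof -
      have len: "length is = d" and pos: "\<And>i. i < d \<Longrightarrow> 1 \<le> is ! i"
        using isS by (auto simp: multi_index_def)
      have sub: "(\<lambda>t. is[j := t]) ` {1..is ! j} \<subseteq> ?S"
      proof clarify
        fix t assume t: "t \<in> {1..is ! j}"
        have mem: "is[j := t] \<in> multi_index d"
          using isS t set_update_subset_insert[of "is" j t] by (auto simp: multi_index_def)
        have "list_all2 (\<le>) (is[j := t]) is"
          using t len j by (auto simp: list_all2_conv_all_nth nth_list_update)
        hence "\<pi> (is[j := t]) \<ge> \<pi> is"
          using pi(1) mem isS by (auto simp: partitions_def)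
        thus "is[j := t] \<in> multi_index d \<and> \<pi> (is[j := t]) \<noteq> 0" using mem False by auto
      qed
      have "inj_on (\<lambda>t. is[j := t]) {1..is ! j}"
        by (rule inj_onI) (metis j len nth_list_update_eq)
      hence "is ! j = card ((\<lambda>t. is[j := t]) ` {1..is ! j})" by (simp add: card_image)
      also have "\<dots> \<le> card ?S" by (rule card_mono[OF finS sub])
      finally show ?thesis using cardS by linarith
    qed
    hence "is \<in> B" using isS by (auto simp: B_def multi_index_def in_set_conv_nth)
    thus ?thesis using le by simp
  qed auto
  thus ?thesis by (intro finite_subset[OF _ fin]) auto
qed

lemma macmahon_has_prod: "(\<lambda>k. macmahon_factor d (Suc k)) has_prod macmahon_gf d"
proof -
  let ?f = "\<lambda>k. macmahon_factor d (Suc k)"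
  have X: "fps_nth (g * (fps_X ^ Suc k * h)) i = 0" if "i \<le> k" for g h :: "rat fps" and i k
  proof -
    have eq: "g * (fps_X ^ Suc k * h) = fps_X ^ Suc k * (g * h)" by (simp only: ac_simps)
    show ?thesis unfolding eq fps_X_power_mult_nth using that by simp
  qed
  have factor: "\<exists>h. ?f k = 1 + fps_X ^ Suc k * h" for k
  proof -
    let ?b = "(Suc k + d - 2) choose (d - 1)"
    let ?u = "1 - fps_X ^ Suc k :: rat fps"
    have "1 - ?u dvd 1 - ?u ^ ?b"
      by (metis one_diff_power_eq dvd_triv_left)
    then obtain h where h: "1 - ?u ^ ?b = fps_X ^ Suc k * h" by (auto simp: dvd_def)
    have n0: "fps_nth (?u ^ ?b) 0 \<noteq> 0" by (simp add: fps_power_zeroth)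
    have "?f k * ?u ^ ?b = 1"
      unfolding macmahon_factor_def using inverse_mult_eq_1[OF n0] by simp
    hence "?f k - 1 = ?f k * (1 - ?u ^ ?b)" by (simp add: algebra_simps)
    hence "?f k = 1 + fps_X ^ Suc k * (h * ?f k)" unfolding h by (simp add: algebra_simps)
    thus ?thesis by blast
  qed
  define P where "P n = (\<Prod>k\<le>n. ?f k)" for n
  have step: "fps_nth (P (Suc n)) i = fps_nth (P n) i" if "i \<le> n" for n i
  proof -
    obtain h where "?f (Suc n) = 1 + fps_X ^ Suc (Suc n) * h" using factor by blast
    hence "P (Suc n) = P n + P n * (fps_X ^ Suc (Suc n) * h)"
      by (simp add: P_def algebra_simps)
    thus ?thesis using X[of i "Suc n" "P n" h] that by simp
  qed
  have stable: "fps_nth (P n) i = fps_nth (P i) i" if "i \<le> n" for n i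
    using that by (induction n rule: dec_induct) (simp_all add: step)
  define L where "L = Abs_fps (\<lambda>i. fps_nth (P i) i)"
  have lim: "P \<longlonglongrightarrow> L"
    by (rule tendsto_fpsI)
       (auto simp: L_def eventually_sequentially intro: stable)
  obtain h where "?f 0 = 1 + fps_X ^ Suc 0 * h" using factor by blast
  hence "fps_nth L 0 = 1" by (simp add: L_def P_def)
  hence "L \<noteq> 0" by auto
  hence prod: "?f has_prod L"
    using lim unfolding has_prod_def raw_has_prod_def P_def by simp
  have uniq: "M = L" if "?f has_prod M" for M
  proof -
    have "?f i \<noteq> 0" for i
    proof -
      obtain h where "?f i = 1 + fps_X ^ Suc i * h" using factor by blast
      hence "fps_nth (?f i) 0 = 1" by simp
      thus ?thesis by auto
    qed
    hence "P \<longlonglongrightarrow> M" using that unfolding has_prod_def raw_has_prod_def P_def by simp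
    thus ?thesis using lim LIMSEQ_unique by blast
  qed
  have "macmahon_gf d = L" unfolding macmahon_gf_def prodinf_def using prod uniq by blast
  thus ?thesis using prod by simp
qed

end

theory Submission
  imports Defs
begin

text \<open>
  To a partition \<pi> attach the array a with entries a(I) = \<pi>(I) - max over l of \<pi>(I + e(l)).
  Since \<pi> has finite support, it is recovered from a by descending induction on the sum of the
  index. Give an index I the weight |I| - d + 1; by the number of indices of each weight,
  MacMahon's product generates the arrays of nonnegative integers by total weight. It remains to
  bound the weight of a for \<pi> \<noteq> 0. For a fixed direction l, telescoping the inequality
  a(I) \<le> \<pi>(I) - \<pi>(I + e(l)) along lines gives \<Sum> a(I) I(l) \<le> |\<pi>|. Summing over l and using
  \<Sum> a(I) \<ge> 1, the weight is at most d |\<pi>| - (d - 1).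
\<close>

section \<open>Weighted arrays and products of geometric series\<close>

text \<open>Multisets of labelled parts: \<open>x\<close> is a part of size \<open>w x\<close> with
  multiplicity \<open>a x\<close>. Forcing zeros off \<open>S\<close> makes each multiset exactly
  one function, so that \<open>card\<close> counts multisets.\<close>

definition weighted_arrays :: "'a set \<Rightarrow> ('a \<Rightarrow> nat) \<Rightarrow> nat \<Rightarrow> ('a \<Rightarrow> nat) set" where
  "weighted_arrays S w n = {a. (\<forall>x. x \<notin> S \<longrightarrow> a x = 0) \<and> (\<Sum>x\<in>S. a x * w x) = n}"

lemma finite_weighted_arrays:
  assumes "finite S" and "\<And>x. x \<in> S \<Longrightarrow> w x > 0"
  shows "finite (weighted_arrays S w n)"
proof -
  have "a x \<le> n" if a: "a \<in> weighted_arrays S w n" and x: "x \<in> S" for a x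
  proof -
    have "a x * w x \<le> n"
      using member_le_sum[OF x, of "\<lambda>x. a x * w x"] a assms(1) by (simp add: weighted_arrays_def)
    moreover have "a x * 1 \<le> a x * w x" using assms(2)[OF x] by (intro mult_le_mono) simp_all
    ultimately show ?thesis by linarith
  qed
  hence "weighted_arrays S w n \<subseteq>
      {a. \<forall>x. (x \<in> S \<longrightarrow> a x \<in> {..n}) \<and> (x \<notin> S \<longrightarrow> a x = 0)}"
    by (auto simp: weighted_arrays_def)
  thus ?thesis using finite_set_of_finite_funs[OF assms(1), of "{..n}" 0] finite_subset by blast
qed

lemma weighted_arrays_zero:
  assumes "finite S" and "\<And>x. x \<in> S \<Longrightarrow> w x > 0"
  shows "weighted_arrays S w 0 = {\<lambda>_. 0}"
  using assms by (fastforce simp: weighted_arrays_def)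

lemma fun_upd_Suc_weighted_arrays:
  assumes "finite S" and "x \<in> S" and "a \<in> weighted_arrays S w n"
  shows "a(x := Suc (a x)) \<in> weighted_arrays S w (n + w x)"
  using assms by (auto simp: weighted_arrays_def sum.remove[OF assms(1,2)] intro!: sum.cong)

lemma inj_fun_upd_Suc: "inj (\<lambda>a. a(x := Suc (a x)))"
proof (rule injI)
  fix a b :: "'a \<Rightarrow> nat"
  assume eq: "a(x := Suc (a x)) = b(x := Suc (b x))"
  show "a = b"
  proof
    fix y show "a y = b y" using fun_cong[OF eq, of y] by (cases "y = x") auto
  qed
qed

text \<open>Split on \<open>a x\<close>: if it is 0, the array lives on \<open>S\<close>; otherwise,
  removing one copy of \<open>x\<close> leaves an array of weight \<open>n - w x\<close>.\<close>

lemma weighted_arrays_insert: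
  assumes S: "finite S" "x \<notin> S"
  shows "weighted_arrays (insert x S) w n = weighted_arrays S w n \<union>
    (if w x \<le> n then (\<lambda>a. a(x := Suc (a x))) ` weighted_arrays (insert x S) w (n - w x) else {})"
    (is "?L = ?R")
proof (intro equalityI subsetI)
  fix a assume a: "a \<in> ?L"
  show "a \<in> ?R"
  proof (cases "a x")
    case 0
    hence "a y = 0" if "y \<notin> S" for y
      using a that by (cases "y = x") (auto simp: weighted_arrays_def)
    hence "a \<in> weighted_arrays S w n" using 0 a S by (auto simp: weighted_arrays_def)
    thus ?thesis by blast
  next
    case (Suc m)
    have sum: "(\<Sum>y\<in>S. (a(x := m)) y * w y) = (\<Sum>y\<in>S. a y * w y)"
      using S by (intro sum.cong) auto
    have "w x \<le> n" "a(x := m) \<in> weighted_arrays (insert x S) w (n - w x)"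
      using a S Suc sum by (auto simp: weighted_arrays_def)
    moreover have "a = (a(x := m))(x := Suc ((a(x := m)) x))" using Suc by auto
    ultimately show ?thesis by (auto intro!: image_eqI)
  qed
next
  fix a assume a: "a \<in> ?R"
  show "a \<in> ?L"
  proof (cases "a \<in> weighted_arrays S w n")
    case True
    thus ?thesis using S by (auto simp: weighted_arrays_def)
  next
    case False
    then obtain b where "w x \<le> n" "a = b(x := Suc (b x))"
        "b \<in> weighted_arrays (insert x S) w (n - w x)"
      using a by (auto split: if_splits)
    thus ?thesis using fun_upd_Suc_weighted_arrays[of "insert x S" x b w "n - w x"] S by simp
  qed
qed

lemma card_weighted_arrays_insert:
  assumes S: "finite S" "x \<notin> S" and w: "\<And>y. y \<in> insert x S \<Longrightarrow> w y > 0"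
  shows "card (weighted_arrays (insert x S) w n) = card (weighted_arrays S w n) +
    (if w x \<le> n then card (weighted_arrays (insert x S) w (n - w x)) else 0)"
proof -
  \<comment> \<open>The two parts of the union differ at \<open>x\<close>: the entry there is 0 in
    the first and positive in the second.\<close>
  have "weighted_arrays S w n \<inter> range (\<lambda>a. a(x := Suc (a x))) = {}"
    using S by (auto simp: weighted_arrays_def)
  hence disj: "weighted_arrays S w n \<inter> (\<lambda>a. a(x := Suc (a x))) ` A = {}" for A
    by blast
  have fin: "finite (weighted_arrays (insert x S) w m)" "finite (weighted_arrays S w m)" for m
    using S w by (auto intro!: finite_weighted_arrays)
  have inj: "inj_on (\<lambda>a. a(x := Suc (a x))) A" for A
    by (rule inj_on_subset[OF inj_fun_upd_Suc]) simp
  show ?thesis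
    by (subst weighted_arrays_insert[OF S])
       (auto simp: card_Un_disjoint[OF _ _ disj] fin card_image[OF inj])
qed

text \<open>Both sides obey one recursion. If \<open>g\<close> is the product over \<open>S\<close>
  and \<open>f\<close> the one over \<open>insert x S\<close>, clearing the new denominator gives
  \<open>f = g + fps_X ^ w x * f\<close>, whose coefficients satisfy the recursion for the
  cardinalities.\<close>

lemma fps_nth_prod_geometric:
  fixes w :: "'a \<Rightarrow> nat"
  assumes "finite S" and "\<And>x. x \<in> S \<Longrightarrow> w x > 0"
  shows "fps_nth (\<Prod>x\<in>S. inverse (1 - fps_X ^ w x) :: 'b::field fps) n =
    of_nat (card (weighted_arrays S w n))"
  using assms
proof (induction S arbitrary: n rule: finite_induct)
  case empty
  have "weighted_arrays {} w n = (if n = 0 then {\<lambda>_. 0} else {})"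
    by (auto simp: weighted_arrays_def)
  thus ?case by simp
next
  case (insert x S n)
  define g where "g = (\<Prod>x\<in>S. inverse (1 - fps_X ^ w x) :: 'b fps)"
  define f where "f = inverse (1 - fps_X ^ w x) * g"
  have wx: "w x > 0" using insert.prems by simp
  have "fps_nth (1 - fps_X ^ w x :: 'b fps) 0 \<noteq> 0" using wx by simp
  hence "inverse (1 - fps_X ^ w x :: 'b fps) * (1 - fps_X ^ w x) = 1"
    by (rule inverse_mult_eq_1)
  moreover have "f - fps_X ^ w x * f = inverse (1 - fps_X ^ w x) * (1 - fps_X ^ w x) * g"
    by (simp add: f_def algebra_simps)
  ultimately have "f - fps_X ^ w x * f = g" by simp
  hence rec: "f = g + fps_X ^ w x * f" by (simp only: diff_eq_eq)
  have nth: "fps_nth f m = fps_nth g m + (if w x \<le> m then fps_nth f (m - w x) else 0)" for m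
    using arg_cong[OF rec, of "\<lambda>h. fps_nth h m"] by (auto simp: fps_X_power_mult_nth)
  have g: "fps_nth g m = of_nat (card (weighted_arrays S w m))" for m
    unfolding g_def using insert by simp
  \<comment> \<open>Strong induction applies because \<open>w x > 0\<close>: the recursion only
    refers to the smaller weight \<open>n - w x\<close>.\<close>
  have "fps_nth f n = of_nat (card (weighted_arrays (insert x S) w n))"
  proof (induction n rule: less_induct)
    case (less n)
    show ?case
      using card_weighted_arrays_insert[OF insert.hyps insert.prems, where n = n] nth[of n] g[of n]
        less[of "n - w x"] wx by (auto split: if_splits)
  qed
  thus ?case using insert by (simp add: f_def g_def)
qed

section \<open>MacMahon's numbers count arrays\<close>

text \<open>On positive indices I this is 1 plus the sum of all I(l) - 1: the number of cells in the
  hook formed by I and the cells before it along each axis.\<close>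

definition hook_weight :: "nat list \<Rightarrow> nat" where
  "hook_weight is = sum_list is + 1 - length is"

text \<open>A finite truncation of the index set, matching the partial products of MacMahon's
  product.\<close>

definition small_indices :: "nat \<Rightarrow> nat \<Rightarrow> nat list set" where
  "small_indices d n = {is \<in> multi_index d. hook_weight is \<le> n}"

lemma multi_index_sum_list:
  assumes "is \<in> multi_index d"
  shows "d \<le> sum_list is"
proof -
  have "sum_list (map (\<lambda>_. 1) is) \<le> sum_list (map (\<lambda>i. i) is)"
    using assms by (intro sum_list_mono) (auto simp: multi_index_def)
  thus ?thesis using assms by (simp add: multi_index_def sum_list_triv)
qed

lemma hook_weight_pos: "is \<in> multi_index d \<Longrightarrow> hook_weight is > 0"
  using multi_index_sum_list[of "is" d] by (auto simp: hook_weight_def multi_index_def)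

text \<open>Lowering every entry by one passes to nonnegative entries with sum \<open>k\<close>, the
  setting of stars and bars.\<close>

lemma hook_weight_level_eq_image:
  "{is \<in> multi_index d. hook_weight is = Suc k} = map Suc ` {l. length l = d \<and> sum_list l = k}"
proof -
  have sum: "sum_list (map Suc l) = sum_list l + length l" for l by (induction l) auto
  have "is \<in> map Suc ` {l. length l = d \<and> sum_list l = k}"
    if "is": "is \<in> multi_index d" "hook_weight is = Suc k" for "is"
  proof (rule image_eqI)
    let ?l = "map (\<lambda>i. i - 1) is"
    show eq: "is = map Suc ?l"
      using "is"(1) by (simp add: multi_index_def o_def) (intro map_idI[symmetric], auto)
    show "?l \<in> {l. length l = d \<and> sum_list l = k}"
      using "is" sum[of ?l] by (simp only: eq[symmetric]) (simp add: multi_index_def hook_weight_def)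
  qed
  thus ?thesis by (auto simp: multi_index_def hook_weight_def sum)
qed

text \<open>Stars and bars, put in the form of the exponent in
  \<open>macmahon_factor d (Suc k)\<close>; this match is the reason for the choice of
  \<open>hook_weight\<close>.\<close>

lemma card_hook_weight_level:
  assumes "d \<ge> 1"
  shows "card {is \<in> multi_index d. hook_weight is = Suc k} = (Suc k + d - 2) choose (d - 1)"
proof -
  have "inj_on (map Suc) A" for A by (simp add: inj_on_def)
  hence "card {is \<in> multi_index d. hook_weight is = Suc k} = (k + d - 1) choose k"
    unfolding hook_weight_level_eq_image by (simp add: card_image card_length_sum_list)
  also have "\<dots> = (k + d - 1) choose (d - 1)"
    using assms binomial_symmetric[of k "k + d - 1"] by simp
  finally show ?thesis using assms by (simp add: numeral_2_eq_2)
qed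

text \<open>An infinite set has \<open>card\<close> 0, so the positive binomial coefficient forces
  finiteness.\<close>

lemma finite_hook_weight_level:
  assumes "d \<ge> 1"
  shows "finite {is \<in> multi_index d. hook_weight is = Suc k}"
proof (rule card_ge_0_finite)
  show "card {is \<in> multi_index d. hook_weight is = Suc k} > 0"
    unfolding card_hook_weight_level[OF assms] by (simp add: zero_less_binomial_iff)
qed

lemma small_indices_eq_UN:
  "small_indices d n = (\<Union>k<n. {is \<in> multi_index d. hook_weight is = Suc k})"
proof -
  have "\<exists>k<n. hook_weight is = Suc k" if "is \<in> multi_index d" "hook_weight is \<le> n" for "is"
    using hook_weight_pos[OF that(1)] that(2) by (cases "hook_weight is") auto
  thus ?thesis by (auto simp: small_indices_def)
qed

lemma finite_small_indices: "d \<ge> 1 \<Longrightarrow> finite (small_indices d n)"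
  unfolding small_indices_eq_UN using finite_hook_weight_level by blast

text \<open>Group the indices by weight: level \<open>Suc k\<close> contributes equal geometric
  series, as many as the exponent in the factor.\<close>

lemma prod_macmahon_factor:
  assumes "d \<ge> 1"
  shows "(\<Prod>k<n. macmahon_factor d (Suc k)) =
    (\<Prod>is\<in>small_indices d n. inverse (1 - fps_X ^ hook_weight is))"
proof -
  have "(\<Prod>is\<in>{is \<in> multi_index d. hook_weight is = Suc k}. inverse (1 - fps_X ^ hook_weight is))
      = macmahon_factor d (Suc k)" for k
  proof -
    have "(\<Prod>is\<in>{is \<in> multi_index d. hook_weight is = Suc k}.
        inverse (1 - fps_X ^ hook_weight is) :: rat fps) =
        (\<Prod>is\<in>{is \<in> multi_index d. hook_weight is = Suc k}. inverse (1 - fps_X ^ Suc k))"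
      by (rule prod.cong) auto
    thus ?thesis
      by (simp only: prod_constant card_hook_weight_level[OF assms] macmahon_factor_def
          fps_inverse_power)
  qed
  moreover have "(\<Prod>is\<in>small_indices d n. inverse (1 - fps_X ^ hook_weight is) :: rat fps) =
      (\<Prod>k<n. \<Prod>is\<in>{is \<in> multi_index d. hook_weight is = Suc k}.
        inverse (1 - fps_X ^ hook_weight is))"
    unfolding small_indices_eq_UN
    by (rule prod.UNION_disjoint) (auto intro: finite_hook_weight_level[OF assms])
  ultimately show ?thesis by simp
qed

text \<open>In a convergent sequence of power series each coefficient is eventually constant, and
  finitely many coefficients settle together. Hence one truncation \<open>M\<close> serves all
  weights up to \<open>N\<close>.\<close>

lemma macmahon_eq_card:
  assumes "d \<ge> 1"
  obtains M where "N \<le> M"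
    "\<And>i. i \<le> N \<Longrightarrow> macmahon d i = of_nat (card (weighted_arrays (small_indices d M) hook_weight i))"
proof -
  let ?P = "\<lambda>n. \<Prod>k\<le>n. macmahon_factor d (Suc k)"
  \<comment> \<open>\<open>has_prod\<close> has a separate case for products with a zero factor;
    excluding it leaves plain convergence of the partial products.\<close>
  have "macmahon_factor d (Suc k) \<noteq> 0" for k
    unfolding macmahon_factor_def by (simp add: fps_inverse_eq_0_iff fps_power_zeroth)
  hence "?P \<longlonglongrightarrow> macmahon_gf d"
    using macmahon_has_prod[of d] unfolding has_prod_def raw_has_prod_def by simp
  hence "\<forall>\<^sub>F n in sequentially. fps_nth (?P n) i = macmahon d i" for i
    unfolding tendsto_fps_iff macmahon_def by blast
  hence "\<forall>\<^sub>F n in sequentially. N \<le> n \<and> (\<forall>i\<in>{..N}. fps_nth (?P n) i = macmahon d i)"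
    by (intro eventually_conj eventually_ge_at_top eventually_ball_finite) auto
  then obtain n where n: "N \<le> n" "\<And>i. i \<le> N \<Longrightarrow> fps_nth (?P n) i = macmahon d i"
    by (auto simp: eventually_sequentially)
  show ?thesis
  \<comment> \<open>The product over \<open>k\<le>n\<close> has factors for the weights 1 to
    \<open>Suc n\<close>, hence the truncation at \<open>Suc n\<close>.\<close>
  proof (rule that[of "Suc n"])
    show "N \<le> Suc n" using n by simp
    fix i assume "i \<le> N"
    hence "macmahon d i =
        fps_nth (\<Prod>is\<in>small_indices d (Suc n). inverse (1 - fps_X ^ hook_weight is)) i"
      using n(2)[of i] prod_macmahon_factor[OF assms, of "Suc n"]
      by (simp add: lessThan_Suc_atMost)
    thus "macmahon d i =
        of_nat (card (weighted_arrays (small_indices d (Suc n)) hook_weight i))"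
      by (subst (asm) fps_nth_prod_geometric[OF finite_small_indices[OF assms]])
         (auto simp: small_indices_def hook_weight_pos)
  qed
qed

lemma macmahon_zero: "d \<ge> 1 \<Longrightarrow> macmahon d 0 = 1"
proof -
  assume d: "d \<ge> 1"
  obtain M where "\<And>i. i \<le> 0 \<Longrightarrow>
      macmahon d i = of_nat (card (weighted_arrays (small_indices d M) hook_weight i))"
    using macmahon_eq_card[OF d] by metis
  moreover have "weighted_arrays (small_indices d M) hook_weight 0 = {\<lambda>_. 0}"
    using finite_small_indices[OF d]
    by (intro weighted_arrays_zero) (auto simp: small_indices_def hook_weight_pos)
  ultimately show ?thesis by simp
qed

text \<open>The all-ones index has weight 1, so adding one to its entry injects the arrays of weight
  \<open>i\<close> into those of weight \<open>Suc i\<close>.\<close>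

lemma mono_macmahon:
  assumes d: "d \<ge> 1"
  shows "mono (macmahon d)"
proof (rule mono_iff_le_Suc[THEN iffD2, rule_format])
  fix i
  obtain M where M: "Suc i \<le> M" "\<And>j. j \<le> Suc i \<Longrightarrow>
      macmahon d j = of_nat (card (weighted_arrays (small_indices d M) hook_weight j))"
    using macmahon_eq_card[OF d] by metis
  let ?S = "small_indices d M" and ?o = "replicate d (1::nat)"
  have w: "hook_weight ?o = 1" by (simp add: hook_weight_def sum_list_replicate)
  have o: "?o \<in> ?S" using M(1) w by (auto simp: small_indices_def multi_index_def)
  have fin: "finite ?S" using d by (rule finite_small_indices)
  have "card (weighted_arrays ?S hook_weight i) \<le> card (weighted_arrays ?S hook_weight (Suc i))"
  proof (rule card_inj_on_le)
    show "inj_on (\<lambda>a. a(?o := Suc (a ?o))) (weighted_arrays ?S hook_weight i)"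
      by (rule inj_on_subset[OF inj_fun_upd_Suc]) simp
    show "(\<lambda>a. a(?o := Suc (a ?o))) ` weighted_arrays ?S hook_weight i
        \<subseteq> weighted_arrays ?S hook_weight (Suc i)"
      using fun_upd_Suc_weighted_arrays[OF fin o, where w = hook_weight and n = i] w by auto
    show "finite (weighted_arrays ?S hook_weight (Suc i))"
      using fin by (intro finite_weighted_arrays) (auto simp: small_indices_def hook_weight_pos)
  qed
  thus "macmahon d i \<le> macmahon d (Suc i)" using M(2)[of i] M(2)[of "Suc i"] by simp
qed

section \<open>The corner array of a partition\<close>

definition shift :: "nat \<Rightarrow> nat list \<Rightarrow> nat list" where
  "shift l is = is[l := Suc (is ! l)]"

definition corners :: "nat \<Rightarrow> (nat list \<Rightarrow> nat) \<Rightarrow> nat list \<Rightarrow> nat" where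
  "corners d \<pi> is =
    (if is \<in> multi_index d then \<pi> is - Max ((\<lambda>l. \<pi> (shift l is)) ` {..<d}) else 0)"

lemma shift_in_multi_index: "is \<in> multi_index d \<Longrightarrow> shift l is \<in> multi_index d"
  using set_update_subset_insert[of "is" l "Suc (is ! l)"]
  by (auto simp: multi_index_def shift_def)

lemma sum_list_shift: "l < length is \<Longrightarrow> sum_list (shift l is) = Suc (sum_list is)"
  by (simp add: shift_def sum_list_update)

lemma partitions_shift_le:
  assumes "\<pi> \<in> partitions d" and "is \<in> multi_index d"
  shows "\<pi> (shift l is) \<le> \<pi> is"
proof -
  have "is ! i \<le> shift l is ! i" if "i < length is" for i
    using that by (cases "i = l") (auto simp: shift_def)
  hence "list_all2 (\<le>) is (shift l is)"
    by (simp add: list_all2_conv_all_nth shift_def)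
  thus ?thesis using assms shift_in_multi_index by (auto simp: partitions_def)
qed

text \<open>Since \<pi> decreases along shifts, the truncated subtraction in \<open>corners\<close>
  is exact; \<open>d \<ge> 1\<close> makes the maximum range over a nonempty set.\<close>

lemma corners_add_Max:
  assumes "\<pi> \<in> partitions d" and "is \<in> multi_index d" and "d \<ge> 1"
  shows "\<pi> is = corners d \<pi> is + Max ((\<lambda>l. \<pi> (shift l is)) ` {..<d})"
proof -
  have "Max ((\<lambda>l. \<pi> (shift l is)) ` {..<d}) \<le> \<pi> is"
    using assms partitions_shift_le[OF assms(1,2)] by (subst Max_le_iff) (auto simp: lessThan_empty_iff)
  thus ?thesis using assms by (simp add: corners_def)
qed

lemma corners_add_shift_le:
  assumes "\<pi> \<in> partitions d" and "is \<in> multi_index d" and "l < d"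
  shows "corners d \<pi> is + \<pi> (shift l is) \<le> \<pi> is"
proof -
  have "\<pi> (shift l is) \<le> Max ((\<lambda>l. \<pi> (shift l is)) ` {..<d})"
    using assms by (intro Max_ge) auto
  thus ?thesis using corners_add_Max[OF assms(1,2)] assms(3) by simp
qed

lemma inj_on_corners:
  assumes d: "d \<ge> 1"
  shows "inj_on (corners d) (partitions d)"
proof (rule inj_onI)
  fix \<pi> \<rho> assume pr: "\<pi> \<in> partitions d" "\<rho> \<in> partitions d" and eq: "corners d \<pi> = corners d \<rho>"
  \<comment> \<open>Beyond the coordinate sums of both supports the two partitions vanish. This
    starts the descending induction, with \<open>B - sum_list is\<close> as measure.\<close>
  define T where "T = {is \<in> multi_index d. \<pi> is \<noteq> 0} \<union> {is \<in> multi_index d. \<rho> is \<noteq> 0}"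
  have "finite T" using pr by (auto simp: T_def partitions_def)
  then obtain B where "\<forall>s\<in>sum_list ` T. s < B"
    using finite_nat_set_iff_bounded[of "sum_list ` T"] by auto
  hence B: "\<pi> is = 0 \<and> \<rho> is = 0" if "is \<in> multi_index d" "sum_list is \<ge> B" for "is"
    using that by (force simp: T_def)
  have "\<pi> is = \<rho> is" if "is \<in> multi_index d" for "is"
    using that
  proof (induction "B - sum_list is" arbitrary: "is" rule: less_induct)
    case less
    show ?case
    proof (cases "sum_list is \<ge> B")
      case True
      thus ?thesis using B less.prems by simp
    next
      case False
      have "\<pi> (shift l is) = \<rho> (shift l is)" if "l < d" for l
      proof (rule less.hyps)
        show "shift l is \<in> multi_index d" using less.prems by (rule shift_in_multi_index)
        have "sum_list (shift l is) = Suc (sum_list is)"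
          using that less.prems by (intro sum_list_shift) (auto simp: multi_index_def)
        thus "B - sum_list (shift l is) < B - sum_list is" using False by simp
      qed
      hence "(\<lambda>l. \<pi> (shift l is)) ` {..<d} = (\<lambda>l. \<rho> (shift l is)) ` {..<d}"
        by (intro image_cong) auto
      thus ?thesis
        using corners_add_Max[OF pr(1) less.prems d] corners_add_Max[OF pr(2) less.prems d] eq
        by simp
    qed
  qed
  thus "\<pi> = \<rho>" using pr by (intro ext) (force simp: partitions_def)
qed

text \<open>Summation by parts in direction \<open>l\<close>: multiply a(I) + \<pi>(I + e(l)) \<le>
  \<pi>(I) by I(l) and sum over the support. Reindexing bounds the shifted sum below by the sum of
  \<pi>(I) (I(l) - 1), and the difference that remains is the volume.\<close>

lemma sum_corners_mult_nth_le:
  assumes pi: "\<pi> \<in> partitions d" and l: "l < d"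
  shows "(\<Sum>is\<in>{is \<in> multi_index d. \<pi> is \<noteq> 0}. corners d \<pi> is * is ! l) \<le> volume d \<pi>"
proof -
  define T where "T = {is \<in> multi_index d. \<pi> is \<noteq> 0}"
  have fin: "finite T" using pi by (simp add: T_def partitions_def)
  have pos: "is ! l \<ge> 1" "length is = d" if "is \<in> T" for "is"
    using that l by (auto simp: T_def multi_index_def)
  \<comment> \<open>\<open>U\<close> holds the support indices with a predecessor in direction
    \<open>l\<close>, and \<open>g\<close> is that predecessor.\<close>
  define U where "U = {is \<in> T. is ! l \<ge> 2}"
  define g where "g js = js[l := js ! l - 1]" for js :: "nat list"
  have shift_g: "shift l (g js) = js" "g js ! l = js ! l - 1" if "js \<in> U" for js
    using that l pos[of js] by (auto simp: U_def g_def shift_def intro: nth_equalityI)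
  have inj: "inj_on g U" by (rule inj_on_inverseI[of _ "shift l"]) (rule shift_g)
  \<comment> \<open>Predecessors stay in the support because \<pi> can only grow when a coordinate
    is lowered.\<close>
  have gU: "g ` U \<subseteq> T"
  proof clarify
    fix js assume js: "js \<in> U"
    have mem: "g js \<in> multi_index d"
      using js set_update_subset_insert[of js l "js ! l - 1"]
      by (fastforce simp: U_def T_def multi_index_def g_def)
    moreover have "\<pi> js \<le> \<pi> (g js)"
      using partitions_shift_le[OF pi mem, of l] shift_g(1)[OF js] by simp
    ultimately show "g js \<in> T" using js by (auto simp: T_def U_def)
  qed
  \<comment> \<open>Indices of \<open>T\<close> outside \<open>U\<close> have
    \<open>is ! l = 1\<close>, so their terms are 0.\<close>
  have "(\<Sum>is\<in>T. \<pi> is * (is ! l - 1)) = (\<Sum>is\<in>U. \<pi> is * (is ! l - 1))"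
    using fin by (intro sum.mono_neutral_right) (auto simp: U_def)
  also have "\<dots> = (\<Sum>is\<in>U. \<pi> (shift l (g is)) * g is ! l)"
    by (intro sum.cong) (auto simp: shift_g)
  also have "\<dots> = (\<Sum>is\<in>g ` U. \<pi> (shift l is) * is ! l)"
    by (simp add: sum.reindex[OF inj])
  also have "\<dots> \<le> (\<Sum>is\<in>T. \<pi> (shift l is) * is ! l)"
    using fin gU by (intro sum_mono2) auto
  finally have reindexed:
    "(\<Sum>is\<in>T. \<pi> is * (is ! l - 1)) \<le> (\<Sum>is\<in>T. \<pi> (shift l is) * is ! l)" .
  have "(\<Sum>is\<in>T. corners d \<pi> is * is ! l) + (\<Sum>is\<in>T. \<pi> (shift l is) * is ! l)
      = (\<Sum>is\<in>T. (corners d \<pi> is + \<pi> (shift l is)) * is ! l)"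
    by (simp add: sum.distrib algebra_simps)
  also have "\<dots> \<le> (\<Sum>is\<in>T. \<pi> is * is ! l)"
    using corners_add_shift_le[OF pi _ l] by (intro sum_mono mult_le_mono) (auto simp: T_def)
  also have "\<dots> = (\<Sum>is\<in>T. \<pi> is + \<pi> is * (is ! l - 1))"
  proof (rule sum.cong)
    fix "is" assume "is \<in> T"
    thus "\<pi> is * is ! l = \<pi> is + \<pi> is * (is ! l - 1)"
      using pos(1)[of "is"] by (cases "is ! l") auto
  qed simp
  also have "\<dots> = volume d \<pi> + (\<Sum>is\<in>T. \<pi> is * (is ! l - 1))"
    by (simp add: sum.distrib volume_def T_def)
  finally show ?thesis using reindexed by (simp add: T_def)
qed

text \<open>At a support index of maximal coordinate sum every shift leaves the support, so the
  corner entry there is the whole positive value of \<pi>.\<close>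

lemma sum_corners_pos:
  assumes pi: "\<pi> \<in> partitions d" and d: "d \<ge> 1" and ne: "{is \<in> multi_index d. \<pi> is \<noteq> 0} \<noteq> {}"
  shows "(\<Sum>is\<in>{is \<in> multi_index d. \<pi> is \<noteq> 0}. corners d \<pi> is) \<ge> 1"
proof -
  define T where "T = {is \<in> multi_index d. \<pi> is \<noteq> 0}"
  have fin: "finite T" using pi by (simp add: T_def partitions_def)
  define m where "m = Max (sum_list ` T)"
  have "m \<in> sum_list ` T" using fin ne by (auto simp: m_def T_def intro!: Max_in)
  then obtain js where js: "js \<in> T" "m = sum_list js" by blast
  have "\<pi> (shift l js) = 0" if "l < d" for l
  proof (rule ccontr)
    assume "\<pi> (shift l js) \<noteq> 0"
    hence "shift l js \<in> T" using js shift_in_multi_index by (auto simp: T_def)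
    hence "sum_list (shift l js) \<le> m" using fin by (simp add: m_def)
    thus False using sum_list_shift[of l js] that js by (simp add: T_def multi_index_def)
  qed
  hence "(\<lambda>l. \<pi> (shift l js)) ` {..<d} = {0}" using d by (auto simp: image_def intro!: exI[of _ 0])
  hence "corners d \<pi> js \<ge> 1"
    using corners_add_Max[OF pi _ d, of js] js by (auto simp: T_def)
  also have "corners d \<pi> js \<le> (\<Sum>is\<in>T. corners d \<pi> is)"
    using js fin by (intro member_le_sum) auto
  finally show ?thesis by (simp add: T_def)
qed

lemma corners_weight_le:
  assumes pi: "\<pi> \<in> partitions d" and d: "d \<ge> 1" and n: "volume d \<pi> \<le> n" "n \<ge> 1"
  shows "(\<Sum>is\<in>{is \<in> multi_index d. \<pi> is \<noteq> 0}. corners d \<pi> is * hook_weight is) \<le> d * n - d + 1"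
proof (cases "{is \<in> multi_index d. \<pi> is \<noteq> 0} = {}")
  case True
  show ?thesis unfolding True by simp
next
  case False
  define T where "T = {is \<in> multi_index d. \<pi> is \<noteq> 0}"
  have w: "hook_weight is + (d - 1) = (\<Sum>l<d. is ! l)" if "is \<in> T" for "is"
    using that d multi_index_sum_list[of "is" d]
    by (auto simp: T_def hook_weight_def multi_index_def sum_list_sum_nth atLeast0LessThan)
  \<comment> \<open>As the corner entries sum to at least 1, one \<open>d - 1\<close> can be
    replaced by one per unit of corner; each then completes a hook weight to a full coordinate
    sum.\<close>
  have "(\<Sum>is\<in>T. corners d \<pi> is * hook_weight is) + (d - 1) \<le>
      (\<Sum>is\<in>T. corners d \<pi> is * hook_weight is) + (d - 1) * (\<Sum>is\<in>T. corners d \<pi> is)"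
    using sum_corners_pos[OF pi d False] by (simp add: T_def)
  also have "\<dots> = (\<Sum>is\<in>T. corners d \<pi> is * (hook_weight is + (d - 1)))"
    by (simp only: sum_distrib_left sum.distrib add_mult_distrib2 mult.commute)
  also have "\<dots> = (\<Sum>is\<in>T. \<Sum>l<d. corners d \<pi> is * is ! l)"
    by (intro sum.cong refl) (simp only: w sum_distrib_left)
  also have "\<dots> = (\<Sum>l<d. \<Sum>is\<in>T. corners d \<pi> is * is ! l)" by (rule sum.swap)
  also have "\<dots> \<le> (\<Sum>l<d. volume d \<pi>)"
    using sum_corners_mult_nth_le[OF pi] by (intro sum_mono) (simp add: T_def)
  also have "\<dots> \<le> d * n" using n by simp
  finally show ?thesis using d by (simp add: T_def)
qed

lemma corners_in_weighted_arrays: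
  assumes pi: "\<pi> \<in> partitions d" and d: "d \<ge> 1" and n: "volume d \<pi> \<le> n" "n \<ge> 1"
    and M: "d * n - d + 1 \<le> M"
  shows "corners d \<pi> \<in> (\<Union>i\<le>d * n - d + 1. weighted_arrays (small_indices d M) hook_weight i)"
proof -
  define T where "T = {is \<in> multi_index d. \<pi> is \<noteq> 0}"
  let ?a = "corners d \<pi>" and ?S = "small_indices d M"
  have fin: "finite T" using pi by (simp add: T_def partitions_def)
  have le: "(\<Sum>is\<in>T. ?a is * hook_weight is) \<le> d * n - d + 1"
    using corners_weight_le[OF pi d n] by (simp add: T_def)
  have supp: "is \<in> T \<and> is \<in> ?S" if a: "?a is \<noteq> 0" for "is"
  proof -
    have "is": "is \<in> T" using a by (auto simp: T_def corners_def split: if_splits)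
    \<comment> \<open>A nonzero entry contributes at least its own hook weight to the total, so its
      index survives the truncation at \<open>M\<close>.\<close>
    have "1 * hook_weight is \<le> ?a is * hook_weight is" using a by (intro mult_le_mono) auto
    also have "\<dots> \<le> (\<Sum>is\<in>T. ?a is * hook_weight is)"
      using "is" fin by (intro member_le_sum) auto
    finally show ?thesis using le M "is" by (simp add: small_indices_def T_def)
  qed
  have "(\<Sum>is\<in>?S. ?a is * hook_weight is) = (\<Sum>is\<in>T. ?a is * hook_weight is)"
    using fin finite_small_indices[OF d] supp by (intro sum.mono_neutral_cong) auto
  thus ?thesis using supp le by (auto simp: weighted_arrays_def)
qed

section \<open>Comparison of the two counts\<close>

lemma num_partitions_upto_eq_card:
  assumes "d \<ge> 1"
  shows "num_partitions_upto d n = card {\<pi> \<in> partitions d. volume d \<pi> \<le> n}"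
proof -
  have "{\<pi> \<in> partitions d. volume d \<pi> \<le> n} = (\<Union>i\<le>n. {\<pi> \<in> partitions d. volume d \<pi> = i})"
    by auto
  thus ?thesis
    unfolding num_partitions_upto_def num_partitions_def
    by (simp, subst card_UN_disjoint) (auto simp: finite_partitions_volume[OF assms])
qed

lemma num_partitions_upto_le_macmahon_upto:
  assumes d: "d \<ge> 1" and n: "n \<ge> 1"
  shows "of_nat (num_partitions_upto d n) \<le> macmahon_upto d (d * n - d + 1)"
proof -
  let ?N = "d * n - d + 1"
  \<comment> \<open>A single \<open>M\<close> for all weights up to \<open>?N\<close> lets one
    injection treat all partitions at once.\<close>
  obtain M where M: "?N \<le> M" "\<And>i. i \<le> ?N \<Longrightarrow>
      macmahon d i = of_nat (card (weighted_arrays (small_indices d M) hook_weight i))"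
    using macmahon_eq_card[OF d] by metis
  let ?W = "weighted_arrays (small_indices d M) hook_weight"
  have fin: "finite (?W i)" for i
    using finite_small_indices[OF d]
    by (intro finite_weighted_arrays) (auto simp: small_indices_def hook_weight_pos)
  have "num_partitions_upto d n \<le> card (\<Union>i\<le>?N. ?W i)"
    unfolding num_partitions_upto_eq_card[OF d]
  proof (rule card_inj_on_le)
    show "inj_on (corners d) {\<pi> \<in> partitions d. volume d \<pi> \<le> n}"
      using inj_on_corners[OF d] by (rule inj_on_subset) auto
    show "corners d ` {\<pi> \<in> partitions d. volume d \<pi> \<le> n} \<subseteq> (\<Union>i\<le>?N. ?W i)"
      using corners_in_weighted_arrays[OF _ d _ n M(1)] by blast
  qed (use fin in auto)
  also have "\<dots> \<le> (\<Sum>i\<le>?N. card (?W i))" by (rule card_UN_le) simp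
  finally have "of_nat (num_partitions_upto d n) \<le> (of_nat (\<Sum>i\<le>?N. card (?W i)) :: rat)"
    by (simp only: of_nat_le_iff)
  also have "\<dots> = macmahon_upto d ?N"
    unfolding macmahon_upto_def of_nat_sum by (intro sum.cong) (auto simp: M(2))
  finally show ?thesis .
qed

text \<open>The zero partition supplies the 1 that cancels \<open>macmahon d 0\<close> in the second
  inequality.\<close>

lemma num_partitions_zero_pos: "d \<ge> 1 \<Longrightarrow> num_partitions d 0 \<ge> 1"
proof -
  assume d: "d \<ge> 1"
  have "(\<lambda>_. 0) \<in> {\<pi> \<in> partitions d. volume d \<pi> = 0}"
    by (simp add: partitions_def volume_def)
  hence "num_partitions d 0 > 0"
    unfolding num_partitions_def using finite_partitions_volume[OF d, of 0] card_gt_0_iff by blast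
  thus ?thesis by simp
qed

theorem mainTheorem3:
  fixes d n :: nat
  assumes "d \<ge> 1" and "n \<ge> 1"
  shows "of_nat (num_partitions_upto d n) \<le> macmahon_upto d (d * n - d + 1) \<and>
         of_nat (num_partitions d n) \<le> of_nat (d * n - d + 1) * macmahon d (d * n - d + 1)"
proof
  show upto: "of_nat (num_partitions_upto d n) \<le> macmahon_upto d (d * n - d + 1)"
    using assms by (rule num_partitions_upto_le_macmahon_upto)
  obtain N where N: "d * n - d + 1 = Suc N" by simp
  \<comment> \<open>Keep only the volumes 0 and \<open>n\<close>, which are distinct since
    \<open>n \<ge> 1\<close>.\<close>
  have "(\<Sum>i\<in>{0, n}. num_partitions d i) \<le> num_partitions_upto d n"
    unfolding num_partitions_upto_def by (rule sum_mono2) auto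
  hence "num_partitions d n + 1 \<le> num_partitions_upto d n"
    using num_partitions_zero_pos[OF assms(1)] assms(2) by simp
  hence "of_nat (num_partitions d n + 1) \<le> (of_nat (num_partitions_upto d n) :: rat)"
    by (simp only: of_nat_le_iff)
  also note upto
  \<comment> \<open>Splitting off the term at 0 leaves \<open>Suc N\<close> terms, each at most the
    last by monotonicity; hence the factor \<open>d * n - d + 1\<close> without a further 1.\<close>
  also have "macmahon_upto d (d * n - d + 1) = 1 + (\<Sum>i\<le>N. macmahon d (Suc i))"
    unfolding macmahon_upto_def N sum.atMost_Suc_shift by (simp add: macmahon_zero[OF assms(1)])
  also have "\<dots> \<le> 1 + (\<Sum>i\<le>N. macmahon d (Suc N))"
    by (intro add_left_mono sum_mono monoD[OF mono_macmahon[OF assms(1)]]) auto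
  finally show "of_nat (num_partitions d n) \<le>
      of_nat (d * n - d + 1) * macmahon d (d * n - d + 1)"
    unfolding N by simp
qed

end
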